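(* Let $G$ be a $2$-connected graph, let $u$ and $v$ be vertices of $G$, and let $\mathcal{C}$ be a set of cycles of $G$. If the graph $\mathcal{P}_\mathcal{C}(G_{uv})$ is connected, then $\mathcal{C}$ spans the cycle space of $G$ (over $\mathbb{F}_2$, i.e. every cycle of $G$ is a symmetric difference of finitely many cycles of $\mathcal{C}$).
   Context: For a path $L$ and vertices $x,y$ on $L$, $L_{xy}$ denotes the subpath of $L$ joining $x$ and $y$. For vertices $u,v$ of a $2$-connected graph $G$, the $uv$ path graph $\mathcal{P}(G_{uv})$ has as vertices the paths in $G$ joining $u$ and $v$, where two such paths $S$ and $T$ are adjacent if $T$ is obtained from $S$ by replacing a subpath $S_{xy}$ of $S$ with a subpath $T_{xy}$ of $T$ internally disjoint from $S_{xy}$; in that case $S\cup T$ contains a unique cycle, namely $S\Delta T = S_{xy}\cup T_{xy}$ (here $F\Delta H$ is the subgraph induced by the edges in exactly one of $F,H$). For a set $\mathcal{C}$ of cycles of $G$, $\mathcal{P}_\mathcal{C}(G_{uv})$ is the spanning subgraph of $\mathcal{P}(G_{uv})$ in which adjacent paths $S,T$ of $\mathcal{P}(G_{uv})$ remain adjacent if and only if the unique cycle contained in $S\cup T$ belongs to $\mathcal{C}$.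
   Formalization: The vertices u and v are assumed distinct; for u = v the path graph is a single vertex, hence connected for every set of cycles, and the claim fails, e.g. for a triangle with the empty set of cycles. *)

theory Defs
  imports Main
begin

text \<open>
  A graph is given by its vertex set \<open>V\<close> and its edge set \<open>E\<close>, an edge being the two-element set
  of its ends. Graphs are not required to be finite.
\<close>

definition simple_graph :: "'a set \<Rightarrow> 'a set set \<Rightarrow> bool" where
  "simple_graph V E \<longleftrightarrow> (\<forall>e\<in>E. e \<subseteq> V \<and> card e = 2)"

definition is_path :: "'a set \<Rightarrow> 'a set set \<Rightarrow> 'a list \<Rightarrow> bool" where
  "is_path V E p \<longleftrightarrow>
     p \<noteq> [] \<and> set p \<subseteq> V \<and> distinct p \<and> successively (\<lambda>x y. {x, y} \<in> E) p"

fun path_edges :: "'a list \<Rightarrow> 'a set set" where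
  "path_edges (x # y # p) = insert {x, y} (path_edges (y # p))"
| "path_edges _ = {}"

definition connected_graph :: "'a set \<Rightarrow> 'a set set \<Rightarrow> bool" where
  "connected_graph V E \<longleftrightarrow>
     V \<noteq> {} \<and> (\<forall>x\<in>V. \<forall>y\<in>V. \<exists>p. is_path V E p \<and> hd p = x \<and> last p = y)"

definition k_connected :: "nat \<Rightarrow> 'a set \<Rightarrow> 'a set set \<Rightarrow> bool" where
  "k_connected k V E \<longleftrightarrow>
     (infinite V \<or> card V > k) \<and>
     (\<forall>X. X \<subseteq> V \<and> finite X \<and> card X < k \<longrightarrow> connected_graph (V - X) {e \<in> E. e \<subseteq> V - X})"

text \<open>
  A cycle is identified with its edge set. The list \<open>p\<close> enumerates its vertices in cyclic order.
\<close>

definition is_cycle :: "'a set \<Rightarrow> 'a set set \<Rightarrow> 'a set set \<Rightarrow> bool" where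
  "is_cycle V E D \<longleftrightarrow>
     (\<exists>p. is_path V E p \<and> length p \<ge> 3 \<and> {last p, hd p} \<in> E \<and>
          D = insert {last p, hd p} (path_edges p))"

text \<open>
  For \<open>u \<noteq> v\<close> a path joining \<open>u\<close> and \<open>v\<close>, as a subgraph, has exactly one vertex sequence that
  starts in \<open>u\<close>; so these lists are in bijection with the paths joining \<open>u\<close> and \<open>v\<close>.
\<close>

definition uv_paths :: "'a set \<Rightarrow> 'a set set \<Rightarrow> 'a \<Rightarrow> 'a \<Rightarrow> 'a list set" where
  "uv_paths V E u v = {p. is_path V E p \<and> hd p = u \<and> last p = v}"

text \<open>
  Here \<open>x # M @ [y]\<close> and \<open>x # N @ [y]\<close> are the subpaths of \<open>S\<close> and \<open>T\<close> joining \<open>x\<close> and \<open>y\<close>, with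
  internal vertices \<open>M\<close> and \<open>N\<close>. As \<open>M\<close> and \<open>N\<close> are disjoint, \<open>M \<noteq> N\<close> only excludes \<open>M = N = []\<close>,
  that is \<open>S = T\<close>.
\<close>

definition path_adj :: "'a list \<Rightarrow> 'a list \<Rightarrow> bool" where
  "path_adj S T \<longleftrightarrow>
     (\<exists>A B M N x y. S = A @ x # M @ y # B \<and> T = A @ x # N @ y # B \<and>
        set M \<inter> set N = {} \<and> M \<noteq> N)"

definition path_graph_edges :: "'a set \<Rightarrow> 'a set set \<Rightarrow> 'a \<Rightarrow> 'a \<Rightarrow> 'a list set set" where
  "path_graph_edges V E u v =
     {{S, T} | S T. S \<in> uv_paths V E u v \<and> T \<in> uv_paths V E u v \<and> path_adj S T}"

definition unique_cycle :: "'a set \<Rightarrow> 'a set set \<Rightarrow> 'a list \<Rightarrow> 'a list \<Rightarrow> 'a set set" where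
  "unique_cycle V E S T = (THE D. is_cycle V E D \<and> D \<subseteq> path_edges S \<union> path_edges T)"

definition restricted_path_graph_edges ::
    "'a set \<Rightarrow> 'a set set \<Rightarrow> 'a set set set \<Rightarrow> 'a \<Rightarrow> 'a \<Rightarrow> 'a list set set" where
  "restricted_path_graph_edges V E C u v =
     {{S, T} | S T. {S, T} \<in> path_graph_edges V E u v \<and> unique_cycle V E S T \<in> C}"

inductive_set F2_span :: "'b set set \<Rightarrow> 'b set set" for X :: "'b set set" where
  zero: "{} \<in> F2_span X"
| add: "D \<in> X \<Longrightarrow> F \<in> F2_span X \<Longrightarrow> sym_diff D F \<in> F2_span X"

definition cycle_space :: "'a set \<Rightarrow> 'a set set \<Rightarrow> 'a set set set" where
  "cycle_space V E = F2_span {D. is_cycle V E D}"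

text \<open>
  The definite description in \<open>unique_cycle\<close> is proper: for adjacent paths there is exactly one
  cycle in \<open>S \<union> T\<close>, and it is the symmetric difference of the edge sets.
\<close>

lemma path_edges_subset: "e \<in> path_edges p \<Longrightarrow> e \<subseteq> set p"
  by (induction p rule: path_edges.induct) auto

lemma finite_path_edges [simp]: "finite (path_edges p)"
  by (induction p rule: path_edges.induct) auto

lemma path_edges_append:
  "path_edges (p @ x # q) = path_edges (p @ [x]) \<union> path_edges (x # q)"
proof (induction p rule: path_edges.induct)
  case (1 a b p)
  then show ?case by auto
next
  case "2_1"
  then show ?case by simp
next
  case ("2_2" a)
  then show ?case by (cases q) auto
qed

lemma path_edges_rev: "path_edges (rev p) = path_edges p"
proof (induction p rule: path_edges.induct)
  case (1 x y p)
  have "path_edges (rev (x # y # p)) = path_edges (rev p @ y # [x])" by simp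
  also have "\<dots> = path_edges (rev p @ [y]) \<union> path_edges [y, x]" by (rule path_edges_append)
  also have "\<dots> = path_edges (rev (y # p)) \<union> {{x, y}}" by auto
  finally show ?case using 1 by auto
qed auto

lemma even_card_sym_diff:
  assumes "finite A" "finite B"
  shows "even (card (sym_diff A B)) \<longleftrightarrow> (even (card A) \<longleftrightarrow> even (card B))"
proof -
  have "card (sym_diff A B) = card (A - B) + card (B - A)"
    using assms by (intro card_Un_disjoint) auto
  moreover have "card A = card (A - B) + card (A \<inter> B)"
    using assms by (metis card_Int_Diff add.commute)
  moreover have "card B = card (B - A) + card (A \<inter> B)"
    using assms by (metis Int_commute card_Int_Diff add.commute)
  ultimately show ?thesis by presburger
qed

definition even_set :: "'a set set \<Rightarrow> bool" where
  "even_set F \<longleftrightarrow> finite F \<and> (\<forall>w. even (card {e \<in> F. w \<in> e}))"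

lemma even_set_sym_diff:
  assumes "even_set F" "even_set H"
  shows "even_set (sym_diff F H)"
proof -
  have "{e \<in> sym_diff F H. w \<in> e} = sym_diff {e \<in> F. w \<in> e} {e \<in> H. w \<in> e}" for w
    by auto
  then show ?thesis
    using assms unfolding even_set_def by (simp add: even_card_sym_diff)
qed

lemma odd_path_degree:
  assumes "distinct p" "length p \<ge> 2"
  shows "odd (card {e \<in> path_edges p. w \<in> e}) \<longleftrightarrow> w = hd p \<or> w = last p"
  using assms
proof (induction p rule: path_edges.induct)
  case (1 x y p)
  show ?case
  proof (cases "p = []")
    case True
    have "{e. e = {x, y} \<and> w \<in> e} = (if w = x \<or> w = y then {{x, y}} else {})" by auto
    with True show ?thesis by simp
  next
    case False
    then have "length (y # p) \<ge> 2" by (cases p) auto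
    with 1 have IH: "odd (card {e \<in> path_edges (y # p). w \<in> e}) \<longleftrightarrow> w = y \<or> w = last (y # p)"
      by auto
    have new: "{x, y} \<notin> path_edges (y # p)"
      using 1(2) path_edges_subset[of "{x, y}" "y # p"] by auto
    have fin: "finite {e \<in> path_edges (y # p). w \<in> e}" by simp
    have ne: "x \<noteq> y" "last p \<noteq> y" "last p \<noteq> x" using 1(2) False by auto
    show ?thesis
    proof (cases "w = x \<or> w = y")
      case True
      then have "{e \<in> path_edges (x # y # p). w \<in> e} =
          insert {x, y} {e \<in> path_edges (y # p). w \<in> e}" by auto
      then have "card {e \<in> path_edges (x # y # p). w \<in> e} =
          Suc (card {e \<in> path_edges (y # p). w \<in> e})" using new fin by simp
      then show ?thesis using IH ne True False by auto
    next
      case w: False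
      then have "{e \<in> path_edges (x # y # p). w \<in> e} = {e \<in> path_edges (y # p). w \<in> e}"
        by auto
      then show ?thesis using IH w False by auto
    qed
  qed
qed auto

lemma closing_edge_notin:
  assumes "distinct p" "length p \<ge> 3"
  shows "{last p, hd p} \<notin> path_edges p"
proof -
  obtain x y z q where p: "p = x # y # z # q"
    using assms(2) by (auto simp: numeral_3_eq_3 Suc_le_length_iff)
  have l: "last p \<noteq> x" "last p \<noteq> y" using assms(1) unfolding p by (auto split: if_splits)
  have "{last p, x} \<notin> path_edges (y # z # q)"
    using path_edges_subset[of "{last p, x}" "y # z # q"] assms(1) p by auto
  then show ?thesis using l unfolding p by (auto simp: doubleton_eq_iff)
qed

lemma is_cycle_even:
  assumes "is_cycle V E D"
  shows "even_set D" "D \<noteq> {}"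
proof -
  obtain p where p: "is_path V E p" "length p \<ge> 3"
      and D: "D = insert {last p, hd p} (path_edges p)"
    using assms unfolding is_cycle_def by blast
  have d: "distinct p" using p unfolding is_path_def by simp
  note new = closing_edge_notin[OF d p(2)]
  note deg = odd_path_degree[OF d]
  have "even (card {e \<in> D. w \<in> e})" for w
  proof (cases "w = hd p \<or> w = last p")
    case True
    then have "{e \<in> D. w \<in> e} = insert {last p, hd p} {e \<in> path_edges p. w \<in> e}"
      using D by auto
    then have "card {e \<in> D. w \<in> e} = Suc (card {e \<in> path_edges p. w \<in> e})" using new by simp
    then show ?thesis using deg[of w] True p(2) by auto
  next
    case False
    then have "{e \<in> D. w \<in> e} = {e \<in> path_edges p. w \<in> e}" using D by auto
    then show ?thesis using deg[of w] False p(2) by auto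
  qed
  then show "even_set D" using D unfolding even_set_def by simp
  show "D \<noteq> {}" using D by simp
qed

lemma even_set_prune:
  assumes "even_set F" "distinct p" "\<forall>w\<in>set (butlast p). \<forall>e\<in>R. w \<notin> e"
    "F \<subseteq> R \<union> path_edges p"
  shows "F \<subseteq> R"
  using assms(2-)
proof (induction p rule: path_edges.induct)
  case (1 x y p)
  have x: "x \<notin> set (y # p)" using 1(2) by simp
  have sub: "{e \<in> F. x \<in> e} \<subseteq> {{x, y}}"
  proof
    fix e assume e: "e \<in> {e \<in> F. x \<in> e}"
    then have "e \<notin> R" using 1(3) by auto
    moreover have "e \<notin> path_edges (y # p)" using path_edges_subset[of e "y # p"] x e by auto
    ultimately show "e \<in> {{x, y}}" using e 1(4) by auto
  qed
  have "{x, y} \<notin> F"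
  proof
    assume "{x, y} \<in> F"
    with sub have "{e \<in> F. x \<in> e} = {{x, y}}" by auto
    then have "card {e \<in> F. x \<in> e} = 1" by simp
    then show False using assms(1) unfolding even_set_def by (metis odd_one)
  qed
  then have "F \<subseteq> R \<union> path_edges (y # p)" using 1(4) by auto
  moreover have "\<forall>w\<in>set (butlast (y # p)). \<forall>e\<in>R. w \<notin> e" using 1(3) by simp
  moreover have "distinct (y # p)" using 1(2) by simp
  ultimately show ?case using 1(1) by blast
qed simp_all

lemma sym_diff_is_cycle:
  assumes S: "is_path V E (A @ x # M @ y # B)" and T: "is_path V E (A @ x # N @ y # B)"
    and disj: "set M \<inter> set N = {}" and ne: "M \<noteq> N"
  shows "is_cycle V E (path_edges (x # M @ [y]) \<union> path_edges (x # N @ [y]))"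
proof -
  have main: "is_cycle V E (path_edges (x # M @ [y]) \<union> path_edges (x # N @ [y]))"
    if S: "is_path V E (A @ x # M @ y # B)" and T: "is_path V E (A @ x # N @ y # B)"
      and disj: "set M \<inter> set N = {}" and ne: "N \<noteq> []" for M N
  proof -
    obtain n N' where N: "N = n # N'" using ne by (cases N) auto
    let ?p = "x # M @ y # rev N"
    have sub: "successively P L" if "successively P (A @ L @ B)" for P L
      using that by (simp add: successively_append_iff)
    have sS: "successively (\<lambda>x y. {x, y} \<in> E) (x # M @ [y])"
      using S sub[of _ "x # M @ [y]"] unfolding is_path_def by simp
    have sT: "successively (\<lambda>x y. {x, y} \<in> E) (x # N @ [y])"
      using T sub[of _ "x # N @ [y]"] unfolding is_path_def by simp
    have flip: "(\<lambda>x y. {y, x} \<in> E) = (\<lambda>x y. {x, y} \<in> E)"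
      by (intro ext) (simp add: insert_commute)
    have "successively (\<lambda>x y. {x, y} \<in> E) (rev (x # N @ [y]))"
      using sT unfolding successively_rev flip .
    then have "successively (\<lambda>x y. {x, y} \<in> E) ((y # rev N) @ [x])" by simp
    then have sR: "successively (\<lambda>x y. {x, y} \<in> E) (y # rev N)" and cl: "{n, x} \<in> E"
      unfolding successively_append_iff by (auto simp: N)
    have "successively (\<lambda>x y. {x, y} \<in> E) ((x # M @ [y]) @ rev N)"
      using sS sR unfolding successively_append_iff by (auto simp: successively_Cons)
    then have sp: "successively (\<lambda>x y. {x, y} \<in> E) ?p" by simp
    have "is_path V E ?p"
      using S T disj sp unfolding is_path_def by auto
    moreover have "length ?p \<ge> 3" using N by simp
    moreover have "last ?p = n" using N by simp
    moreover have "path_edges (x # M @ [y]) \<union> path_edges (x # N @ [y]) =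
        insert {n, x} (path_edges ?p)"
    proof -
      have "path_edges ?p = path_edges (x # M @ [y]) \<union> path_edges (y # rev N)"
        using path_edges_append[of "x # M" y "rev N"] by simp
      moreover have "path_edges (y # rev N) = path_edges (N @ [y])"
        using path_edges_rev[of "N @ [y]"] by simp
      moreover have "path_edges (x # N @ [y]) = insert {n, x} (path_edges (N @ [y]))"
        by (simp add: N insert_commute)
      ultimately show ?thesis by auto
    qed
    ultimately show ?thesis using cl unfolding is_cycle_def by (intro exI[of _ ?p]) auto
  qed
  show ?thesis
  proof (cases "N = []")
    case True
    then show ?thesis using main[OF T S] disj ne by (simp add: Un_commute Int_commute)
  next
    case False
    then show ?thesis using main[OF S T disj] by simp
  qed
qed

lemma path_edges_segment:
  "path_edges (A @ x # M @ y # B) =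
     path_edges (A @ [x]) \<union> path_edges (x # M @ [y]) \<union> path_edges (y # B)"
  using path_edges_append[of A x "M @ y # B"] path_edges_append[of "x # M" y B] by auto

lemma segment_edge_notin:
  assumes "distinct (A @ x # M @ y # B)" "distinct (A @ x # N @ y # B)"
    "set M \<inter> set N = {}" "M \<noteq> N" "e \<in> path_edges (x # M @ [y])"
  shows "e \<notin> path_edges (A @ x # N @ y # B)"
proof
  assume e': "e \<in> path_edges (A @ x # N @ y # B)"
  have two: "\<exists>a b. e = {a, b} \<and> a \<noteq> b" if "e \<in> path_edges p" "distinct p" for p
    using that by (induction p rule: path_edges.induct) auto
  have e1: "e \<subseteq> insert x (insert y (set M))"
    using path_edges_subset[OF assms(5)] by auto
  have "e \<subseteq> set (A @ x # N @ y # B)" using path_edges_subset[OF e'] .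
  then have "e \<subseteq> {x, y}" using e1 assms(1,3) by (fastforce simp: disjoint_iff)
  then have exy: "e = {x, y}" using two[OF e' assms(2)] by auto
  have nil: "L = []" if "{x, y} \<in> path_edges (x # L @ [y])" "distinct (x # L @ [y])" for L
  proof (rule ccontr)
    assume "L \<noteq> []"
    then have "length (x # L @ [y]) \<ge> 3" by (cases L) auto
    then show False using closing_edge_notin[OF that(2)] that(1) by (simp add: insert_commute)
  qed
  have M: "M = []" using nil[of M] assms(1,5) exy by auto
  have "{x, y} \<notin> path_edges (A @ [x])"
    using path_edges_subset[of "{x, y}" "A @ [x]"] assms(1) by auto
  moreover have "{x, y} \<notin> path_edges (y # B)"
    using path_edges_subset[of "{x, y}" "y # B"] assms(1) by auto
  ultimately have "{x, y} \<in> path_edges (x # N @ [y])"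
    using e' exy path_edges_segment[of A x N y B] by auto
  then have "N = []" using nil[of N] assms(2) by auto
  then show False using M assms(4) by simp
qed

lemma path_adj_cycle:
  assumes S: "is_path V E S" and T: "is_path V E T" and adj: "path_adj S T"
  shows "is_cycle V E D \<and> D \<subseteq> path_edges S \<union> path_edges T \<longleftrightarrow>
    D = sym_diff (path_edges S) (path_edges T)"
proof -
  obtain A B M N x y where S': "S = A @ x # M @ y # B" and T': "T = A @ x # N @ y # B"
    and disj: "set M \<inter> set N = {}" and ne: "M \<noteq> N"
    using adj unfolding path_adj_def by blast
  let ?K = "sym_diff (path_edges S) (path_edges T)"
  have dS: "distinct S" and dT: "distinct T" using S T unfolding is_path_def by auto
  have notT: "e \<notin> path_edges T" if "e \<in> path_edges (x # M @ [y])" for e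
    using segment_edge_notin[OF dS[unfolded S'] dT[unfolded T'] disj ne that] T' by simp
  have notS: "e \<notin> path_edges S" if "e \<in> path_edges (x # N @ [y])" for e
    using segment_edge_notin[OF dT[unfolded T'] dS[unfolded S'] _ ne[symmetric] that] disj S'
    by auto
  have K: "?K = path_edges (x # M @ [y]) \<union> path_edges (x # N @ [y])"
  proof -
    have "path_edges S = path_edges (A @ [x]) \<union> path_edges (x # M @ [y]) \<union> path_edges (y # B)"
      "path_edges T = path_edges (A @ [x]) \<union> path_edges (x # N @ [y]) \<union> path_edges (y # B)"
      unfolding S' T' by (rule path_edges_segment)+
    then show ?thesis using notT notS by auto
  qed
  have cyc: "is_cycle V E ?K"
    unfolding K by (rule sym_diff_is_cycle[OF S[unfolded S'] T[unfolded T'] disj ne])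
  define z where "z = hd (M @ [y])"
  have xM: "path_edges (x # M @ [y]) = insert {x, z} (path_edges (M @ [y]))"
    unfolding z_def by (cases M) auto
  have empty: "F = {}" if F: "even_set F" "F \<subseteq> path_edges S \<union> path_edges T" "{x, z} \<notin> F" for F
  proof -
    have "path_edges S \<subseteq> path_edges T \<union> path_edges (x # M @ [y])"
      unfolding S' T' path_edges_segment by auto
    then have "F \<subseteq> path_edges T \<union> path_edges (M @ [y])" using F xM by auto
    moreover have "\<forall>w\<in>set (butlast (M @ [y])). \<forall>e\<in>path_edges T. w \<notin> e"
    proof (intro ballI notI)
      fix w e assume w: "w \<in> set (butlast (M @ [y]))" "e \<in> path_edges T" "w \<in> e"
      then have "w \<in> set M" "w \<in> set T" using path_edges_subset[of e T] by auto
      then show False using disj dS unfolding S' T' by auto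
    qed
    moreover have "distinct (M @ [y])" using dS unfolding S' by simp
    ultimately have "F \<subseteq> path_edges T"
      using even_set_prune[OF F(1)] by blast
    then show ?thesis using even_set_prune[OF F(1) dT, of "{}"] by simp
  qed
  show ?thesis
  proof
    assume D: "is_cycle V E D \<and> D \<subseteq> path_edges S \<union> path_edges T"
    have "{x, z} \<in> D" using empty[of D] D is_cycle_even by metis
    moreover have "{x, z} \<in> ?K" unfolding K xM by simp
    ultimately have "{x, z} \<notin> sym_diff D ?K" by blast
    moreover have "even_set (sym_diff D ?K)"
      using D by (intro even_set_sym_diff is_cycle_even(1)[OF cyc]) (auto intro: is_cycle_even(1))
    moreover have "sym_diff D ?K \<subseteq> path_edges S \<union> path_edges T" using D by blast
    ultimately have "sym_diff D ?K = {}" using empty by blast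
    then show "D = ?K" by blast
  qed (use cyc in auto)
qed

lemma unique_cycle_eq:
  assumes "is_path V E S" "is_path V E T" "path_adj S T"
  shows "unique_cycle V E S T = sym_diff (path_edges S) (path_edges T)"
  unfolding unique_cycle_def path_adj_cycle[OF assms] by simp

end

theory Submission
  imports Defs
begin

text \<open>
  Along a walk in the restricted path graph the edge sets of consecutive paths differ by a cycle of
  \<open>C\<close>, so for any two \<open>uv\<close> paths \<open>S\<close>, \<open>T\<close> the set \<open>S \<Delta> T\<close> lies in the span of \<open>C\<close>. Conversely every
  cycle \<open>D\<close> is of the form \<open>S \<Delta> T\<close>: by 2-connectedness there are disjoint paths from \<open>u\<close> and \<open>v\<close> to
  distinct vertices \<open>a\<close>, \<open>b\<close> of \<open>D\<close>, and joining them through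
  either arc of \<open>D\<close> between \<open>a\<close> and \<open>b\<close> gives \<open>S\<close> and \<open>T\<close>.
\<close>

section \<open>Spans over the two-element field\<close>

text \<open>The rule \<open>add\<close> admits one generator at a time; induction on the first
  summand and associativity extend this to arbitrary sums.\<close>

lemma F2_span_sym_diff:
  assumes "F \<in> F2_span X" "H \<in> F2_span X"
  shows "sym_diff F H \<in> F2_span X"
  using assms(1)
proof induction
  case zero
  then show ?case using assms(2) by simp
next
  case (add D F)
  have "sym_diff (sym_diff D F) H = sym_diff D (sym_diff F H)" by blast
  then show ?case using F2_span.add[OF add.hyps(1) add.IH] by simp
qed

lemma F2_span_base:
  assumes "D \<in> X" shows "D \<in> F2_span X"
  using F2_span.add[OF assms F2_span.zero] by simp

lemma F2_span_least:
  assumes "X \<subseteq> F2_span Y" shows "F2_span X \<subseteq> F2_span Y"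
proof
  fix F assume "F \<in> F2_span X"
  then show "F \<in> F2_span Y"
    by induction (use assms in \<open>auto intro: F2_span.zero F2_span_sym_diff\<close>)
qed

section \<open>Disjoint paths to a set\<close>

lemma is_path_append_iff:
  assumes "p \<noteq> []" "q \<noteq> []"
  shows "is_path V E (p @ q) \<longleftrightarrow>
    is_path V E p \<and> is_path V E q \<and> set p \<inter> set q = {} \<and> {last p, hd q} \<in> E"
  using assms unfolding is_path_def by (auto simp: successively_append_iff)

lemma is_path_rev: "is_path V E (rev p) \<longleftrightarrow> is_path V E p"
  unfolding is_path_def by (simp add: insert_commute)

text \<open>Both pieces contain \<open>z\<close>; their own distinctness keeps \<open>z\<close> out
  of \<open>p\<close> and \<open>q\<close>, so only \<open>p\<close> against \<open>q\<close> has to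
  be checked.\<close>

lemma is_path_join:
  assumes "is_path V E (p @ [z])" "is_path V E (z # q)" "set p \<inter> set q = {}"
  shows "is_path V E (p @ z # q)"
  using assms unfolding is_path_def by (auto simp: successively_append_iff)

lemma is_path_prefix: "is_path V E (p @ z # q) \<Longrightarrow> is_path V E (p @ [z])"
  unfolding is_path_def by (auto simp: successively_append_iff)

lemma is_path_suffix: "is_path V E (p @ z # q) \<Longrightarrow> is_path V E (z # q)"
  unfolding is_path_def by (auto simp: successively_append_iff)

lemma hd_append_Cons: "hd (p @ z # q) = hd (p @ [z])"
  by (cases p) auto

lemma first_hit:
  assumes "is_path V E r" "set r \<inter> X \<noteq> {}"
  obtains p z where "is_path V E (p @ [z])" "hd (p @ [z]) = hd r" "z \<in> X" "set p \<inter> X = {}"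
    "set (p @ [z]) \<subseteq> set r"
proof -
  have "\<exists>x\<in>set r. x \<in> X" using assms(2) by blast
  then obtain p z q where r: "r = p @ z # q" "z \<in> X" "\<forall>y\<in>set p. y \<notin> X"
    using split_list_first_prop[of r "\<lambda>x. x \<in> X"] by blast
  have "is_path V E (p @ [z])" using is_path_prefix[OF assms(1)[unfolded r(1)]] .
  moreover have "hd (p @ [z]) = hd r" unfolding r(1) by (rule hd_append_Cons[symmetric])
  ultimately show thesis using that[of p z] r by auto
qed

lemma two_connected_path:
  assumes "k_connected 2 V E" "x \<in> V" "y \<in> V"
  obtains p where "is_path V E p" "hd p = x" "last p = y"
proof -
  \<comment> \<open>Deleting the empty set is the instance of 2-connectedness that says the graph
    itself is connected.\<close>
  have "connected_graph (V - {}) {e \<in> E. e \<subseteq> V - {}}"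
    using assms(1) unfolding k_connected_def
    by (metis card.empty empty_subsetI finite.emptyI zero_less_numeral)
  then obtain p where "is_path V {e \<in> E. e \<subseteq> V} p" "hd p = x" "last p = y"
    using assms unfolding connected_graph_def by auto
  moreover from this(1) have "is_path V E p"
    unfolding is_path_def by (auto elim!: successively_mono)
  ultimately show thesis using that by blast
qed

lemma two_connected_path_avoiding:
  assumes "k_connected 2 V E" "w \<in> V" "x \<in> V" "y \<in> V" "x \<noteq> w" "y \<noteq> w"
  obtains p where "is_path V E p" "hd p = x" "last p = y" "w \<notin> set p"
proof -
  have "{w} \<subseteq> V \<and> finite {w} \<and> card {w} < 2" using assms(2) by simp
  then have "connected_graph (V - {w}) {e \<in> E. e \<subseteq> V - {w}}"
    using assms(1) unfolding k_connected_def by blast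
  then obtain p where p: "is_path (V - {w}) {e \<in> E. e \<subseteq> V - {w}} p" "hd p = x" "last p = y"
    using assms unfolding connected_graph_def by auto
  then have "is_path V E p" "w \<notin> set p"
    unfolding is_path_def by (auto elim!: successively_mono)
  with p show thesis using that by blast
qed

text \<open>Only the last vertices are required to lie in \<open>X\<close>: earlier ones may lie
  there too, so paths can be extended and rerouted freely and are trimmed afterwards with
  \<open>first_hit\<close>.\<close>

definition linked :: "'a set \<Rightarrow> 'a set set \<Rightarrow> 'a set \<Rightarrow> 'a \<Rightarrow> 'a \<Rightarrow> bool" where
  "linked V E X u v \<longleftrightarrow> (\<exists>p q. is_path V E p \<and> is_path V E q \<and> hd p = u \<and> hd q = v \<and>
     last p \<in> X \<and> last q \<in> X \<and> set p \<inter> set q = {})"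

lemma linkedI:
  assumes "is_path V E p" "is_path V E q" "hd p = u" "hd q = v"
    "last p \<in> X" "last q \<in> X" "set p \<inter> set q = {}"
  shows "linked V E X u v"
  using assms unfolding linked_def by blast

lemma linked_commute: "linked V E X u v \<Longrightarrow> linked V E X v u"
  unfolding linked_def by (metis Int_commute)

text \<open>If \<open>v\<close> lies on \<open>q\<close>, cut \<open>q\<close> there; if
  \<open>v\<close> is on neither path, prepend it to \<open>q\<close>. If \<open>v\<close> lies on
  \<open>p\<close>, it can reach \<open>X\<close> both along the rest of \<open>p\<close> and
  through \<open>w\<close> along \<open>q\<close>, and a path from \<open>u\<close> avoiding
  \<open>v\<close> decides which of the two is left to \<open>v\<close>.\<close>

lemma linked_neighbour:
  assumes conn: "k_connected 2 V E" and "X \<subseteq> V" "s \<in> X" "s \<noteq> v"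
    and "u \<in> V" "v \<in> V" "u \<noteq> v" and vw: "{v, w} \<in> E" and link: "linked V E X u w"
  shows "linked V E X u v"
proof -
  obtain p q where p: "is_path V E p" "hd p = u" "last p \<in> X"
    and q_path: "is_path V E q" and q_hd: "hd q = w" and q_last: "last q \<in> X"
    and disj: "set p \<inter> set q = {}"
    using link unfolding linked_def by blast
  have qne: "q \<noteq> []" using q_path unfolding is_path_def by simp
  have v1: "is_path V E [v]" using \<open>v \<in> V\<close> unfolding is_path_def by simp
  have vq: "is_path V E (v # q)" if "v \<notin> set q"
    using is_path_append_iff[of "[v]" q V E] v1 q_path q_hd qne that vw by simp
  consider (q) "v \<in> set q" | (p) "v \<in> set p" | (new) "v \<notin> set p" "v \<notin> set q" by blast
  then show ?thesis
  proof cases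
    case q
    then obtain q1 q2 where q': "q = q1 @ v # q2" by (meson split_list)
    show ?thesis
      by (rule linkedI[OF p(1) is_path_suffix[OF q_path[unfolded q']]])
        (use p q_last disj q' in auto)
  next
    case new
    show ?thesis
      by (rule linkedI[OF p(1) vq]) (use new p q_last disj qne in auto)
  next
    case in_p: p
    then obtain p1 p2 where p': "p = p1 @ v # p2" by (meson split_list)
    have vnq: "v \<notin> set q" using in_p disj by blast
    have vp2: "is_path V E (v # p2)" using is_path_suffix[OF p(1)[unfolded p']] .
    obtain t where t: "is_path V E t" "hd t = u" "last t = s" "v \<notin> set t"
      using two_connected_path_avoiding[OF conn] assms by (metis subsetD)
    have "s \<in> set t" using t unfolding is_path_def by auto
    then have "set t \<inter> (set p2 \<union> set q \<union> X) \<noteq> {}" using \<open>s \<in> X\<close> by blast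
    \<comment> \<open>Stop \<open>t\<close> at its first vertex in \<open>p2\<close>,
      \<open>q\<close> or \<open>X\<close>. From \<open>z\<close>, \<open>u\<close> continues along
      whichever path was hit, or stops in \<open>X\<close>; \<open>v\<close> takes a route that is
      still free.\<close>
    then obtain r z where r: "is_path V E (r @ [z])" "hd (r @ [z]) = u"
      and z: "z \<in> set p2 \<union> set q \<union> X" and rd: "set r \<inter> (set p2 \<union> set q \<union> X) = {}"
      and rt: "set (r @ [z]) \<subseteq> set t"
      using first_hit[OF t(1)] t(2) by metis
    have vr: "v \<notin> set r" "v \<noteq> z" using rt t(4) by auto
    have hd_r: "hd (r @ z # l) = u" for l using r(2) hd_append_Cons by metis
    consider "z \<in> set q" | "z \<in> set p2" | "z \<in> X" "z \<notin> set q" using z by blast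
    then show ?thesis
    proof cases
      case 1
      then obtain q1 q2 where q': "q = q1 @ z # q2" by (meson split_list)
      have "is_path V E (r @ z # q2)"
        using is_path_join[OF r(1)] is_path_suffix q_path rd unfolding q' by fastforce
      from linkedI[OF this vp2 hd_r] show ?thesis
        using p(3) q_last rd vr disj unfolding p' q' by (auto split: if_splits)
    next
      case 2
      then obtain a b where p2: "p2 = a @ z # b" by (meson split_list)
      have "is_path V E (z # b)"
        using is_path_suffix[of V E "v # a" z b] vp2 unfolding p2 by simp
      then have "is_path V E (r @ z # b)"
        using is_path_join[OF r(1)] rd unfolding p2 by fastforce
      moreover have "v \<notin> set b" using vp2 unfolding p2 is_path_def by simp
      ultimately show ?thesis
        using linkedI[OF _ vq[OF vnq] hd_r, of b _ X] p(3) q_last qne rd vr disj unfolding p' p2 by (auto split: if_splits)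
    next
      case 3
      from linkedI[OF r(1) vq[OF vnq] r(2)] show ?thesis
        using 3 q_last qne rd vr by auto
    qed
  qed
qed

text \<open>The one-vertex path at \<open>v\<close> serves \<open>v\<close>, and \<open>u\<close>
  reaches \<open>s\<close> in the graph without \<open>v\<close>.\<close>

lemma linked_if_in:
  assumes conn: "k_connected 2 V E" and "X \<subseteq> V" "s \<in> X" "s \<noteq> v"
    and "u \<in> V" "v \<in> X" "u \<noteq> v"
  shows "linked V E X u v"
proof -
  obtain p where p: "is_path V E p" "hd p = u" "last p = s" "v \<notin> set p"
    using two_connected_path_avoiding[OF conn] assms by (metis subsetD)
  have "is_path V E [v]" using assms unfolding is_path_def by auto
  from linkedI[OF p(1) this p(2)] show ?thesis using p assms by auto
qed

text \<open>
  The set version of Menger's theorem for two paths. The induction runs along a path from \<open>v\<close>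
  to \<open>X\<close>; if \<open>u\<close> is the second vertex of that path, the induction hypothesis for the pair \<open>v\<close>, \<open>u\<close>
  is the claim with the roles of the two ends exchanged.
\<close>

lemma two_connected_linked:
  assumes conn: "k_connected 2 V E" and X: "X \<subseteq> V" "s \<in> X" "t \<in> X" "s \<noteq> t"
    and "u \<in> V" "v \<in> V" "u \<noteq> v"
  shows "linked V E X u v"
proof -
  \<comment> \<open>This supplies the target in \<open>X\<close> that a path avoiding
    \<open>y\<close> needs.\<close>
  have other: "\<exists>s\<in>X. s \<noteq> y" for y using X by metis
  have main: "linked V E X x y"
    if "is_path V E l" "hd l = y" "last l \<in> X" "x \<in> V" "x \<noteq> y" for l x y
    using that
  proof (induction l arbitrary: x y)
    case Nil
    then show ?case unfolding is_path_def by simp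
  next
    case (Cons a l)
    have [simp]: "a = y" using Cons.prems by simp
    obtain s' where s': "s' \<in> X" "s' \<noteq> y" using other by blast
    have yV: "y \<in> V" using Cons.prems unfolding is_path_def by simp
    show ?case
    proof (cases "l = []")
      case True
      then have "y \<in> X" using Cons.prems by simp
      then show ?thesis using linked_if_in[OF conn X(1) s'] Cons.prems by blast
    next
      case False
      then have l: "is_path V E l" "last l \<in> X" and e: "{y, hd l} \<in> E" and "y \<notin> set l"
        using Cons.prems is_path_append_iff[of "[a]" l V E] by auto
      then have "y \<noteq> hd l" using False by auto
      show ?thesis
      proof (cases "x = hd l")
        case True
        then show ?thesis
          using Cons.IH[OF l(1) refl l(2) yV \<open>y \<noteq> hd l\<close>] linked_commute by metis
      next
        case False
        have "linked V E X x (hd l)" using Cons.IH[OF l(1) refl l(2)] Cons.prems False by blast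
        then show ?thesis
          using linked_neighbour[OF conn X(1) s' _ yV _ e] Cons.prems by blast
      qed
    qed
  qed
  obtain l where "is_path V E l" "hd l = v" "last l = s"
    using two_connected_path[OF conn] assms by (metis subsetD)
  then show ?thesis using main assms by blast
qed

section \<open>Every cycle is the difference of two paths\<close>

lemma path_edges_append_ne:
  assumes "p \<noteq> []" "q \<noteq> []"
  shows "path_edges (p @ q) = insert {last p, hd q} (path_edges p \<union> path_edges q)"
proof -
  obtain p' x where p: "p = p' @ [x]" using assms(1) by (metis rev_exhaust)
  obtain y q' where q: "q = y # q'" using assms(2) by (cases q) auto
  show ?thesis using path_edges_append[of p' x "y # q'"] unfolding p q by auto
qed

text \<open>The body of \<open>is_cycle\<close> with its vertex list exposed, so that the starting
  point can be changed.\<close>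

definition cyclic_enum :: "'a set \<Rightarrow> 'a set set \<Rightarrow> 'a set set \<Rightarrow> 'a list \<Rightarrow> bool" where
  "cyclic_enum V E D p \<longleftrightarrow> is_path V E p \<and> length p \<ge> 3 \<and> {last p, hd p} \<in> E \<and>
     D = insert {last p, hd p} (path_edges p)"

text \<open>The closing edge and the edge between \<open>p\<close> and \<open>q\<close> exchange
  roles.\<close>

lemma cyclic_enum_rotate:
  assumes "cyclic_enum V E D (p @ q)"
  shows "cyclic_enum V E D (q @ p)"
proof (cases "p = [] \<or> q = []")
  case True
  then show ?thesis using assms by auto
next
  case False
  then have ne: "p \<noteq> []" "q \<noteq> []" by auto
  show ?thesis
    using assms ne unfolding cyclic_enum_def is_path_append_iff[OF ne]
      is_path_append_iff[OF ne(2,1)] path_edges_append_ne[OF ne] path_edges_append_ne[OF ne(2,1)]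
    by (auto simp: insert_commute)
qed

lemma cycle_eq_path_diff:
  assumes conn: "k_connected 2 V E" and uv: "u \<in> V" "v \<in> V" "u \<noteq> v" and D: "is_cycle V E D"
  obtains S T where "S \<in> uv_paths V E u v" "T \<in> uv_paths V E u v"
    "D = sym_diff (path_edges S) (path_edges T)"
proof -
  obtain c where c: "cyclic_enum V E D c"
    using D unfolding is_cycle_def cyclic_enum_def by blast
  then have cp: "is_path V E c" "length c \<ge> 3" unfolding cyclic_enum_def by auto
  then obtain s t c' where "c = s # t # c'" by (auto simp: numeral_3_eq_3 Suc_le_length_iff)
  with cp have "set c \<subseteq> V" "s \<in> set c" "t \<in> set c" "s \<noteq> t" unfolding is_path_def by auto
  from two_connected_linked[OF conn this uv] obtain p q where
    p: "is_path V E p" "hd p = u" "last p \<in> set c" and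
    q: "is_path V E q" "hd q = v" "last q \<in> set c" and pq: "set p \<inter> set q = {}"
    unfolding linked_def by blast
  have "set p \<inter> set c \<noteq> {}" "set q \<inter> set c \<noteq> {}"
    using p q last_in_set unfolding is_path_def by blast+
  \<comment> \<open>Trimmed at the first hit, the two paths meet the cycle only in \<open>a\<close>
    and \<open>b\<close>.\<close>
  then obtain P a Q b where
    P: "is_path V E (P @ [a])" "hd (P @ [a]) = u" "a \<in> set c" "set P \<inter> set c = {}"
      "set (P @ [a]) \<subseteq> set p" and
    Q: "is_path V E (Q @ [b])" "hd (Q @ [b]) = v" "b \<in> set c" "set Q \<inter> set c = {}"
      "set (Q @ [b]) \<subseteq> set q"
    using first_hit[OF p(1)] first_hit[OF q(1)] p(2) q(2) by metis
  have disj: "set (P @ [a]) \<inter> set (Q @ [b]) = {}" using P(5) Q(5) pq by blast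
  \<comment> \<open>Rotate the enumeration to start at \<open>a\<close>; then \<open>b\<close>
    splits the rest into the interiors \<open>M\<close> and \<open>N\<close> of the two
    arcs.\<close>
  obtain c1 c2 where c12: "c = c1 @ a # c2" using P(3) by (meson split_list)
  have "b \<in> set (c2 @ c1)" using Q(3) disj unfolding c12 by auto
  then obtain M N where MN: "c2 @ c1 = M @ b # N" by (meson split_list)
  have "cyclic_enum V E D ((a # c2) @ c1)" using cyclic_enum_rotate c c12 by metis
  then have ce: "cyclic_enum V E D (a # M @ b # N)" using MN by simp
  have "set (a # c2 @ c1) = set c" unfolding c12 by auto
  then have setc: "set c = insert a (insert b (set M \<union> set N))" unfolding MN by auto
  have path: "is_path V E (a # M @ b # N)" and cl: "{last (b # N), a} \<in> E"
    and Deq: "D = insert {last (b # N), a} (path_edges (a # M @ b # N))"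
    \<comment> \<open>A cycle has at least three vertices, so the arcs cannot both be the single
      edge \<open>ab\<close>; this gives \<open>M \<noteq> rev N\<close> below.\<close>
    and len: "M \<noteq> [] \<or> N \<noteq> []"
    using ce unfolding cyclic_enum_def by (auto split: if_splits)
  have arc1: "is_path V E (a # M @ [b])" using is_path_prefix[of V E "a # M" b N] path by simp
  have bN: "is_path V E (b # N)" using is_path_suffix[of V E "a # M" b N] path by simp
  have dist: "distinct (a # M @ b # N)" using path unfolding is_path_def by blast
  \<comment> \<open>The second arc uses the closing edge and runs backwards through
    \<open>N\<close>.\<close>
  have arc2: "is_path V E (a # rev N @ [b])"
  proof -
    have "is_path V E ((b # N) @ [a])"
      using is_path_append_iff[of "b # N" "[a]" V E] bN path cl dist
      unfolding is_path_def by auto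
    then show ?thesis using is_path_rev[of V E "(b # N) @ [a]"] by simp
  qed
  have glue: "P @ a # L @ b # rev Q \<in> uv_paths V E u v"
    if L: "is_path V E (a # L @ [b])" "set L \<subseteq> set M \<union> set N" for L
  proof -
    have "is_path V E (P @ a # L @ [b])"
      using is_path_join[OF P(1) L(1)] P(4) L(2) setc by auto
    moreover have "is_path V E (b # rev Q)" using Q(1) is_path_rev[of V E "Q @ [b]"] by simp
    moreover have "set (P @ a # L) \<inter> set (rev Q) = {}" using disj Q(4) L(2) setc by auto
    ultimately have "is_path V E (P @ a # L @ b # rev Q)"
      using is_path_join[of V E "P @ a # L" b "rev Q"] by simp
    moreover have "hd (P @ a # L @ b # rev Q) = u" using P(2) hd_append_Cons by metis
    moreover have "last (P @ a # L @ b # rev Q) = v"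
      using Q(2) by (cases Q) auto
    ultimately show ?thesis unfolding uv_paths_def by simp
  qed
  define S where "S = P @ a # M @ b # rev Q"
  define T where "T = P @ a # rev N @ b # rev Q"
  have S: "S \<in> uv_paths V E u v" using glue[OF arc1] unfolding S_def by simp
  have T: "T \<in> uv_paths V E u v" using glue[OF arc2] unfolding T_def by simp
  have MN_disj: "set M \<inter> set (rev N) = {}" using dist by auto
  then have "M \<noteq> rev N" using len by auto
  with MN_disj have adj: "path_adj S T" unfolding path_adj_def S_def T_def by blast
  \<comment> \<open>One inclusion suffices: by \<open>path_adj_cycle\<close>, the only cycle inside
    the union of adjacent paths is their symmetric difference.\<close>
  have "D \<subseteq> path_edges S \<union> path_edges T"
  proof -
    have "path_edges (a # M @ b # N) = path_edges (a # M @ [b]) \<union> path_edges (b # N)"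
      using path_edges_append[of "a # M" b N] by simp
    moreover have "path_edges (a # rev N @ [b]) =
        insert {last (b # N), a} (path_edges (b # N))"
      using path_edges_append_ne[of "b # N" "[a]"] path_edges_rev[of "(b # N) @ [a]"] by simp
    ultimately show ?thesis
      unfolding Deq S_def T_def path_edges_segment by blast
  qed
  then have "D = sym_diff (path_edges S) (path_edges T)"
    using path_adj_cycle[of V E S T D] S T adj D unfolding uv_paths_def by blast
  then show thesis using that S T by blast
qed

section \<open>Walks in the restricted path graph\<close>

lemma path_adj_sym: "path_adj S T \<Longrightarrow> path_adj T S"
  unfolding path_adj_def by (metis Int_commute)

text \<open>Edges are unordered, so unfolding recovers the two paths only up to exchange; adjacency
  and symmetric difference are both invariant under it.\<close>

lemma restricted_edge_diff:
  assumes "{S, T} \<in> restricted_path_graph_edges V E C u v"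
  shows "sym_diff (path_edges S) (path_edges T) \<in> C"
proof -
  obtain S' T' where e: "{S, T} = {S', T'}" "unique_cycle V E S' T' \<in> C"
    "{S', T'} \<in> path_graph_edges V E u v"
    using assms unfolding restricted_path_graph_edges_def by blast
  then have "S' \<in> uv_paths V E u v \<and> T' \<in> uv_paths V E u v \<and> path_adj S' T'"
    unfolding path_graph_edges_def by (auto simp: doubleton_eq_iff dest: path_adj_sym)
  then have "sym_diff (path_edges S') (path_edges T') \<in> C"
    using e(2) unique_cycle_eq unfolding uv_paths_def by fastforce
  then show ?thesis using e(1) by (auto simp: doubleton_eq_iff Un_commute)
qed

text \<open>The differences of consecutive paths telescope: every intermediate path cancels modulo
  2.\<close>

lemma restricted_walk_diff:
  assumes "successively (\<lambda>S T. {S, T} \<in> restricted_path_graph_edges V E C u v) W" "W \<noteq> []"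
  shows "sym_diff (path_edges (hd W)) (path_edges (last W)) \<in> F2_span C"
  using assms
proof (induction W rule: induct_list012)
  case (3 S T W)
  let ?d = "\<lambda>S T. sym_diff (path_edges S) (path_edges T)"
  let ?L = "last (T # W)"
  have "?d S T \<in> C" by (rule restricted_edge_diff[of _ _ V E C u v]) (use 3(3) in simp)
  moreover have "?d T ?L \<in> F2_span C" using 3 by simp
  ultimately have "sym_diff (?d S T) (?d T ?L) \<in> F2_span C" by (rule F2_span.add)
  moreover have "sym_diff (?d S T) (?d T ?L) = ?d S ?L" by blast
  ultimately show ?case by simp
qed (auto intro: F2_span.zero)

theorem theorem3:
  fixes V :: "'a set" and E :: "'a set set" and u v :: 'a and C :: "'a set set set"
  assumes "simple_graph V E"
    and "k_connected 2 V E"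
    and "u \<in> V" and "v \<in> V" and "u \<noteq> v"
    and "C \<subseteq> {D. is_cycle V E D}"
    and "connected_graph (uv_paths V E u v) (restricted_path_graph_edges V E C u v)"
  shows "F2_span C = cycle_space V E"
proof
  show "F2_span C \<subseteq> cycle_space V E"
    unfolding cycle_space_def using assms(6) by (intro F2_span_least) (auto intro: F2_span_base)
  have "D \<in> F2_span C" if cyc: "is_cycle V E D" for D
  proof -
    obtain S T where S: "S \<in> uv_paths V E u v" and T: "T \<in> uv_paths V E u v"
      and D: "D = sym_diff (path_edges S) (path_edges T)"
      using cycle_eq_path_diff[OF assms(2-5) cyc] .
    \<comment> \<open>Connectedness joins \<open>S\<close> to \<open>T\<close> by a path
      \<open>W\<close>, along which the differences sum to \<open>D\<close>.\<close>
    obtain W where "is_path (uv_paths V E u v) (restricted_path_graph_edges V E C u v) W"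
      "hd W = S" "last W = T"
      using assms(7) S T unfolding connected_graph_def by blast
    then show ?thesis using restricted_walk_diff[of V E C u v W] D unfolding is_path_def by simp
  qed
  then show "cycle_space V E \<subseteq> F2_span C"
    unfolding cycle_space_def by (intro F2_span_least) auto
qed

end
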